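(* Let $r\ge 2$, let $\mathcal{F}$ be a nondegenerate family of $r$-graphs, and let $\mathfrak{H}$ be a hereditary class of $\mathcal{F}$-free $r$-graphs. If $\mathcal{F}$ is both edge-stable and vertex-extendable with respect to $\mathfrak{H}$, then $\mathcal{F}$ is degree-stable with respect to $\mathfrak{H}$.
   Context: An $r$-graph is a collection of $r$-subsets (edges) of a finite vertex set; $|\mathcal{H}|$ is its number of edges, $\delta(\mathcal{H})$ its minimum degree (degree of $v$ = number of edges containing $v$), and $\mathcal{H}-v$ is obtained by deleting $v$ and all edges containing it. $\mathcal{H}$ is $\mathcal{F}$-free if it contains no member of $\mathcal{F}$ as a subgraph. $\mathrm{ex}(n,\mathcal{F})$ is the maximum number of edges in an $n$-vertex $\mathcal{F}$-free $r$-graph, and $\pi(\mathcal{F})=\lim_{n\to\infty}\mathrm{ex}(n,\mathcal{F})/\binom{n}{r}$; $\mathcal{F}$ is nondegenerate if $\pi(\mathcal{F})>0$. A class $\mathfrak{H}$ is hereditary if every subgraph of a member of $\mathfrak{H}$ is also in $\mathfrak{H}$. Given $\mathfrak{H}$ a family of $\mathcal{F}$-free $r$-graphs: (i) $\mathcal{F}$ is edge-stable w.r.t. $\mathfrak{H}$ if for every $\delta>0$ there exist $\varepsilon>0$ and $n_0$ such that every $\mathcal{F}$-free $r$-graph $\mathcal{H}$ on $n\ge n_0$ vertices with $|\mathcal{H}|\ge(\pi(\mathcal{F})/r!-\varepsilon)n^r$ becomes a member of $\mathfrak{H}$ after removing at most $\delta n^r$ edges; (ii) $\mathcal{F}$ is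 degree-stable w.r.t. $\mathfrak{H}$ if there exist $\varepsilon>0$ and $n_0$ such that every $\mathcal{F}$-free $r$-graph $\mathcal{H}$ on $n\ge n_0$ vertices with $\delta(\mathcal{H})\ge(\pi(\mathcal{F})/(r-1)!-\varepsilon)n^{r-1}$ is a member of $\mathfrak{H}$; (iii) $\mathcal{F}$ is vertex-extendable w.r.t. $\mathfrak{H}$ if there exist $\varepsilon>0$ and $n_0$ such that for every $\mathcal{F}$-free $r$-graph $\mathcal{H}$ on $n\ge n_0$ vertices with $\delta(\mathcal{H})\ge(\pi(\mathcal{F})/(r-1)!-\varepsilon)n^{r-1}$: if $\mathcal{H}-v\in\mathfrak{H}$ for some vertex $v$, then $\mathcal{H}\in\mathfrak{H}$. *)

theory Defs
  imports Complex_Main "HOL-Library.Infinite_Typeclass"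
begin

datatype 'a hypergraph = Hypergraph (verts: "'a set") (edges: "'a set set")

definition rgraph :: "nat \<Rightarrow> 'a hypergraph \<Rightarrow> bool" where
  "rgraph r H \<longleftrightarrow> finite (verts H) \<and> (\<forall>e\<in>edges H. e \<subseteq> verts H \<and> card e = r)"

text \<open>Subgraphs are not necessarily induced or spanning.\<close>

definition subgraph :: "'a hypergraph \<Rightarrow> 'a hypergraph \<Rightarrow> bool" where
  "subgraph G H \<longleftrightarrow>
     verts G \<subseteq> verts H \<and> edges G \<subseteq> edges H \<and> (\<forall>e\<in>edges G. e \<subseteq> verts G)"

definition isomorphic :: "'a hypergraph \<Rightarrow> 'b hypergraph \<Rightarrow> bool" where
  "isomorphic G H \<longleftrightarrow>
     (\<exists>f. bij_betw f (verts G) (verts H) \<and> edges H = (\<lambda>e. f ` e) ` edges G)"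

definition family_free :: "'a hypergraph set \<Rightarrow> 'a hypergraph \<Rightarrow> bool" where
  "family_free \<F> H \<longleftrightarrow> \<not> (\<exists>F\<in>\<F>. \<exists>G. subgraph G H \<and> isomorphic F G)"

definition vertex_degree :: "'a hypergraph \<Rightarrow> 'a \<Rightarrow> nat" where
  "vertex_degree H v = card {e \<in> edges H. v \<in> e}"

definition min_degree :: "'a hypergraph \<Rightarrow> nat" where
  "min_degree H = Min (vertex_degree H ` verts H)"

definition delete_vertex :: "'a hypergraph \<Rightarrow> 'a \<Rightarrow> 'a hypergraph" where
  "delete_vertex H v = Hypergraph (verts H - {v}) {e \<in> edges H. v \<notin> e}"

definition delete_edges :: "'a hypergraph \<Rightarrow> 'a set set \<Rightarrow> 'a hypergraph" where
  "delete_edges H D = Hypergraph (verts H) (edges H - D)"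

text \<open>The set below is finite, so the supremum is a maximum whenever the set is nonempty. It is empty
  only if \<open>\<F>\<close> contains an edgeless graph on at most \<open>n\<close> vertices, and then the supremum is \<open>0\<close>.
  The vertex type is taken to be infinite so that there are \<open>n\<close>-vertex graphs for every \<open>n\<close>.\<close>

definition turan_number :: "nat \<Rightarrow> 'a::infinite hypergraph set \<Rightarrow> nat \<Rightarrow> nat" where
  "turan_number r \<F> n =
     Sup {card (edges H) | H. rgraph r H \<and> card (verts H) = n \<and> family_free \<F> H}"

definition turan_density :: "nat \<Rightarrow> 'a::infinite hypergraph set \<Rightarrow> real" where
  "turan_density r \<F> = lim (\<lambda>n. real (turan_number r \<F> n) / real (n choose r))"

definition nondegenerate :: "nat \<Rightarrow> 'a::infinite hypergraph set \<Rightarrow> bool" where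
  "nondegenerate r \<F> \<longleftrightarrow> turan_density r \<F> > 0"

text \<open>Closure is under literal subgraphs only; closure under isomorphism is not required.\<close>

definition hereditary :: "'a hypergraph set \<Rightarrow> bool" where
  "hereditary \<HH> \<longleftrightarrow> (\<forall>H\<in>\<HH>. \<forall>G. subgraph G H \<longrightarrow> G \<in> \<HH>)"

definition edge_stable ::
  "nat \<Rightarrow> 'a::infinite hypergraph set \<Rightarrow> 'a hypergraph set \<Rightarrow> bool" where
  "edge_stable r \<F> \<HH> \<longleftrightarrow>
     (\<forall>\<delta>::real. \<delta> > 0 \<longrightarrow> (\<exists>\<epsilon>::real. \<epsilon> > 0 \<and> (\<exists>n0::nat. \<forall>H.
        rgraph r H \<and> family_free \<F> H \<and> card (verts H) \<ge> n0 \<and>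
        real (card (edges H)) \<ge> (turan_density r \<F> / fact r - \<epsilon>) * real (card (verts H)) ^ r
        \<longrightarrow> (\<exists>D \<subseteq> edges H. real (card D) \<le> \<delta> * real (card (verts H)) ^ r
               \<and> delete_edges H D \<in> \<HH>))))"

definition large_min_degree ::
  "nat \<Rightarrow> 'a::infinite hypergraph set \<Rightarrow> real \<Rightarrow> 'a hypergraph \<Rightarrow> bool" where
  "large_min_degree r \<F> \<epsilon> H \<longleftrightarrow>
     real (min_degree H)
       \<ge> (turan_density r \<F> / fact (r - 1) - \<epsilon>) * real (card (verts H)) ^ (r - 1)"

definition degree_stable ::
  "nat \<Rightarrow> 'a::infinite hypergraph set \<Rightarrow> 'a hypergraph set \<Rightarrow> bool" where
  "degree_stable r \<F> \<HH> \<longleftrightarrow>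
     (\<exists>\<epsilon>::real. \<epsilon> > 0 \<and> (\<exists>n0::nat. \<forall>H.
        rgraph r H \<and> family_free \<F> H \<and> card (verts H) \<ge> n0 \<and> large_min_degree r \<F> \<epsilon> H
        \<longrightarrow> H \<in> \<HH>))"

definition vertex_extendable ::
  "nat \<Rightarrow> 'a::infinite hypergraph set \<Rightarrow> 'a hypergraph set \<Rightarrow> bool" where
  "vertex_extendable r \<F> \<HH> \<longleftrightarrow>
     (\<exists>\<epsilon>::real. \<epsilon> > 0 \<and> (\<exists>n0::nat. \<forall>H.
        rgraph r H \<and> family_free \<F> H \<and> card (verts H) \<ge> n0 \<and> large_min_degree r \<F> \<epsilon> H
        \<longrightarrow> (\<exists>v\<in>verts H. delete_vertex H v \<in> \<HH>) \<longrightarrow> H \<in> \<HH>))"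

end

theory Submission imports Defs "HOL-Library.FuncSet" begin

text \<open>Let \<open>p k\<close> be the fraction of \<open>k\<close>-subsets \<open>U\<close> of the vertex set such that the subgraph induced on \<open>U\<close>
  is not in \<open>\<HH>\<close>. If that subgraph has large minimum degree and is not in \<open>\<HH>\<close>, then vertex-extendability
  shows that no \<open>U - {v}\<close> induces a member of \<open>\<HH>\<close> either; hence \<open>p (k + 1) \<le> p k + b (k + 1)\<close>, where \<open>b k\<close>
  is the probability that a random \<open>k\<close>-subset induces a subgraph of small minimum degree.
  This probability is exponentially small in \<open>k\<close>: if the link of \<open>v\<close> is too sparse on \<open>U\<close>, then \<open>U\<close> contains
  too many sequences of \<open>t\<close> pairwise disjoint non-edges of the link (\<open>t\<close> a small multiple of \<open>k\<close>), while the
  proportion of such sequences is preserved on average when passing to a random subset.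
  So the sum of \<open>b k\<close> over \<open>k > m\<close> is below \<open>1/2\<close> for a suitable constant \<open>m\<close>.
  Finally, edge-stability with \<open>\<delta> = 1 / (2 m^r)\<close> gives \<open>p m \<le> 1/2\<close>, because a random \<open>m\<close>-subset contains none
  of the removed edges with probability at least \<open>1/2\<close>. Hence \<open>p n < 1\<close> for the full vertex set.\<close>

text \<open>If \<open>M\<close> consists of \<open>s\<close>-sets, the two functions below count the sequences of \<open>t\<close> pairwise disjoint
  subsets of \<open>S\<close> that are in \<open>M\<close>, respectively that have size \<open>s\<close> (in terms of \<open>n = card S\<close>).\<close>

fun ordered_matchings :: "'a set set \<Rightarrow> nat \<Rightarrow> 'a set \<Rightarrow> nat" where
  "ordered_matchings M 0 S = 1"
| "ordered_matchings M (Suc t) S = (\<Sum>B | B \<in> M \<and> B \<subseteq> S. ordered_matchings M t (S - B))"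

fun block_seqs :: "nat \<Rightarrow> nat \<Rightarrow> nat \<Rightarrow> nat" where
  "block_seqs s 0 n = 1"
| "block_seqs s (Suc t) n = (n choose s) * block_seqs s t (n - s)"

lemma block_seqs_pos: "t * s \<le> n \<Longrightarrow> block_seqs s t n > 0"
  by (induction t arbitrary: n) auto

text \<open>Both sides count the pairs of a \<open>k\<close>-subset of an \<open>n\<close>-set and a block sequence inside it.\<close>

lemma block_seqs_choose:
  assumes "t * s \<le> k" "k \<le> n"
  shows "block_seqs s t k * (n choose k) = block_seqs s t n * ((n - t * s) choose (k - t * s))"
  using assms
proof (induction t arbitrary: n k)
  case (Suc t)
  have sk: "s \<le> k" and le: "t * s \<le> k - s" "k - s \<le> n - s" using Suc.prems by auto
  have "block_seqs s (Suc t) k * (n choose k)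
      = block_seqs s t (k - s) * ((n choose k) * (k choose s))" by simp
  also have "\<dots> = (n choose s) * (block_seqs s t (k - s) * ((n - s) choose (k - s)))"
    using choose_mult[OF sk Suc.prems(2)] by simp
  also have "\<dots> = (n choose s) * (block_seqs s t (n - s) * ((n - s - t * s) choose (k - s - t * s)))"
    using Suc.IH[OF le] by simp
  finally show ?case by (simp add: algebra_simps)
qed auto

lemma bij_betw_supersets:
  assumes "finite S" "B \<subseteq> S" "card B \<le> k"
  shows "bij_betw (\<lambda>U. U - B) {U. U \<subseteq> S \<and> card U = k \<and> B \<subseteq> U}
           {U. U \<subseteq> S - B \<and> card U = k - card B}"
proof (rule bij_betwI[where g = "\<lambda>U. U \<union> B"])
  have fB: "finite B" using assms finite_subset by blast
  show "(\<lambda>U. U - B) \<in> {U. U \<subseteq> S \<and> card U = k \<and> B \<subseteq> U} \<rightarrow> {U. U \<subseteq> S - B \<and> card U = k - card B}"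
    using fB by (auto simp: card_Diff_subset)
  show "(\<lambda>U. U \<union> B) \<in> {U. U \<subseteq> S - B \<and> card U = k - card B} \<rightarrow> {U. U \<subseteq> S \<and> card U = k \<and> B \<subseteq> U}"
  proof safe
    fix U assume U: "U \<subseteq> S - B" "card U = k - card B"
    have "finite U" using U assms(1) finite_subset by blast
    then have "card (U \<union> B) = card U + card B" using U fB by (intro card_Un_disjoint) auto
    then show "card (U \<union> B) = k" using U assms by simp
  qed (use assms in auto)
qed auto

lemma card_supersets:
  assumes "finite S" "B \<subseteq> S" "card B \<le> k"
  shows "card {U. U \<subseteq> S \<and> card U = k \<and> B \<subseteq> U} = ((card S - card B) choose (k - card B))"
proof -
  have "finite B" using assms finite_subset by blast
  then have "card (S - B) = card S - card B" using assms by (simp add: card_Diff_subset)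
  then show ?thesis
    using bij_betw_same_card[OF bij_betw_supersets[OF assms]] assms(1)
      n_subsets[of "S - B" "k - card B"] by simp
qed

lemma sum_matchings_subsets:
  assumes M: "\<And>B. B \<in> M \<Longrightarrow> card B = s"
    and "finite S" "t * s \<le> k"
  shows "(\<Sum>U | U \<subseteq> S \<and> card U = k. ordered_matchings M t U)
       = ordered_matchings M t S * ((card S - t * s) choose (k - t * s))"
  using assms(2,3)
proof (induction t arbitrary: S k)
  case 0
  then show ?case by (simp add: n_subsets)
next
  case (Suc t)
  have fP: "finite {U. U \<subseteq> S \<and> Q U}" for Q
    using Suc.prems(1) by (auto intro: finite_subset[of _ "Pow S"])
  have "(\<Sum>U | U \<subseteq> S \<and> card U = k. ordered_matchings M (Suc t) U)
      = (\<Sum>U | U \<subseteq> S \<and> card U = k. \<Sum>B | B \<in> {B. B \<in> M \<and> B \<subseteq> S} \<and> B \<subseteq> U. ordered_matchings M t (U - B))"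
    by (auto intro!: sum.cong)
  also have "\<dots> = (\<Sum>B | B \<in> M \<and> B \<subseteq> S. \<Sum>U | U \<in> {U. U \<subseteq> S \<and> card U = k} \<and> B \<subseteq> U. ordered_matchings M t (U - B))"
    using fP[of "\<lambda>U. card U = k"] fP[of "\<lambda>B. B \<in> M"]
    by (intro sum.swap_restrict) (auto simp: conj_commute)
  also have "\<dots> = (\<Sum>B | B \<in> M \<and> B \<subseteq> S. ordered_matchings M t (S - B) * ((card S - Suc t * s) choose (k - Suc t * s)))"
  proof (rule sum.cong[OF refl])
    fix B assume B: "B \<in> {B. B \<in> M \<and> B \<subseteq> S}"
    then have cB: "card B = s" using M by auto
    have fB: "finite B" using B Suc.prems finite_subset by blast
    have "(\<Sum>U | U \<in> {U. U \<subseteq> S \<and> card U = k} \<and> B \<subseteq> U. ordered_matchings M t (U - B))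
        = (\<Sum>U | U \<subseteq> S - B \<and> card U = k - s. ordered_matchings M t U)"
      using bij_betw_supersets[of S B k] B Suc.prems cB
      by (intro sum.reindex_bij_betw) auto
    also have "\<dots> = ordered_matchings M t (S - B) * ((card (S - B) - t * s) choose (k - s - t * s))"
      using Suc.prems by (intro Suc.IH) auto
    also have "card (S - B) - t * s = card S - Suc t * s"
      using B fB cB by (simp add: card_Diff_subset)
    finally show "(\<Sum>U | U \<in> {U. U \<subseteq> S \<and> card U = k} \<and> B \<subseteq> U. ordered_matchings M t (U - B))
        = ordered_matchings M t (S - B) * ((card S - Suc t * s) choose (k - Suc t * s))" by (simp add: algebra_simps)
  qed
  finally show ?case by (simp add: sum_distrib_right)
qed

lemma matchings_le:
  fixes c :: real
  assumes M: "\<And>B. B \<in> M \<Longrightarrow> card B = s" and "c \<ge> 0" and "finite S"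
    and "\<And>S'. S' \<subseteq> S \<Longrightarrow> card S \<le> card S' + t * s \<Longrightarrow>
           real (card {B. B \<in> M \<and> B \<subseteq> S'}) \<le> c * real (card S' choose s)"
  shows "real (ordered_matchings M t S) \<le> c ^ t * real (block_seqs s t (card S))"
  using assms(3,4)
proof (induction t arbitrary: S)
  case (Suc t)
  have "real (ordered_matchings M (Suc t) S)
      \<le> (\<Sum>B | B \<in> M \<and> B \<subseteq> S. c ^ t * real (block_seqs s t (card S - s)))"
    unfolding ordered_matchings.simps of_nat_sum
  proof (rule sum_mono)
    fix B assume "B \<in> {B. B \<in> M \<and> B \<subseteq> S}"
    then have B: "B \<in> M" "B \<subseteq> S" and fB: "finite B" using Suc.prems(1) finite_subset by auto
    have cSB: "card (S - B) = card S - s" using B fB M by (simp add: card_Diff_subset)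
    have "real (ordered_matchings M t (S - B)) \<le> c ^ t * real (block_seqs s t (card (S - B)))"
    proof (rule Suc.IH)
      fix S' assume S': "S' \<subseteq> S - B" "card (S - B) \<le> card S' + t * s"
      show "real (card {B. B \<in> M \<and> B \<subseteq> S'}) \<le> c * real (card S' choose s)"
        using S' cSB by (intro Suc.prems(2)) auto
    qed (use Suc.prems in auto)
    then show "real (ordered_matchings M t (S - B)) \<le> c ^ t * real (block_seqs s t (card S - s))"
      using cSB by simp
  qed
  also have "\<dots> = real (card {B. B \<in> M \<and> B \<subseteq> S}) * (c ^ t * real (block_seqs s t (card S - s)))"
    by simp
  also have "\<dots> \<le> (c * real (card S choose s)) * (c ^ t * real (block_seqs s t (card S - s)))"
    using Suc.prems(2)[of S] assms(2) by (intro mult_right_mono) auto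
  finally show ?case by (simp add: algebra_simps)
qed auto

lemma matchings_ge:
  fixes c :: real
  assumes M: "\<And>B. B \<in> M \<Longrightarrow> card B = s" and "c \<ge> 0" and "finite S"
    and "\<And>S'. S' \<subseteq> S \<Longrightarrow> card S \<le> card S' + t * s \<Longrightarrow>
           real (card {B. B \<in> M \<and> B \<subseteq> S'}) \<ge> c * real (card S' choose s)"
  shows "real (ordered_matchings M t S) \<ge> c ^ t * real (block_seqs s t (card S))"
  using assms(3,4)
proof (induction t arbitrary: S)
  case (Suc t)
  have "c ^ Suc t * real (block_seqs s (Suc t) (card S))
      = (c * real (card S choose s)) * (c ^ t * real (block_seqs s t (card S - s)))"
    by (simp add: algebra_simps)
  also have "\<dots> \<le> real (card {B. B \<in> M \<and> B \<subseteq> S}) * (c ^ t * real (block_seqs s t (card S - s)))"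
    using Suc.prems(2)[of S] assms(2) by (intro mult_right_mono) auto
  also have "\<dots> = (\<Sum>B | B \<in> M \<and> B \<subseteq> S. c ^ t * real (block_seqs s t (card S - s)))"
    by simp
  also have "\<dots> \<le> real (ordered_matchings M (Suc t) S)"
    unfolding ordered_matchings.simps of_nat_sum
  proof (rule sum_mono)
    fix B assume "B \<in> {B. B \<in> M \<and> B \<subseteq> S}"
    then have B: "B \<in> M" "B \<subseteq> S" and fB: "finite B" using Suc.prems(1) finite_subset by auto
    have cSB: "card (S - B) = card S - s" using B fB M by (simp add: card_Diff_subset)
    have "real (ordered_matchings M t (S - B)) \<ge> c ^ t * real (block_seqs s t (card (S - B)))"
    proof (rule Suc.IH)
      fix S' assume S': "S' \<subseteq> S - B" "card (S - B) \<le> card S' + t * s"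
      show "real (card {B. B \<in> M \<and> B \<subseteq> S'}) \<ge> c * real (card S' choose s)"
        using S' cSB by (intro Suc.prems(2)) auto
    qed (use Suc.prems in auto)
    then show "real (ordered_matchings M t (S - B)) \<ge> c ^ t * real (block_seqs s t (card S - s))"
      using cSB by simp
  qed
  finally show ?case .
qed auto

lemma card_matching_rich_subsets_le:
  fixes c c' :: real
  assumes M: "\<And>B. B \<in> M \<Longrightarrow> card B = s" and "finite S" "t * s \<le> k" "k \<le> card S" "c' > 0"
    and up: "real (ordered_matchings M t S) \<le> c ^ t * real (block_seqs s t (card S))"
    and A: "\<And>U. U \<in> A \<Longrightarrow> U \<subseteq> S \<and> card U = k \<and> real (ordered_matchings M t U) \<ge> c' ^ t * real (block_seqs s t k)"
  shows "real (card A) \<le> (c / c') ^ t * real (card S choose k)"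
proof -
  let ?P = "real (block_seqs s t k)"
  have P: "?P > 0" using block_seqs_pos assms(3) by simp
  have "real (card A) * (c' ^ t * ?P) = (\<Sum>U\<in>A. c' ^ t * ?P)" by simp
  also have "\<dots> \<le> (\<Sum>U\<in>A. real (ordered_matchings M t U))" using A by (intro sum_mono) auto
  also have "\<dots> \<le> (\<Sum>U | U \<subseteq> S \<and> card U = k. real (ordered_matchings M t U))"
    using A assms(2) by (intro sum_mono2) (auto intro: finite_subset[of _ "Pow S"])
  also have "\<dots> = real (ordered_matchings M t S) * real ((card S - t * s) choose (k - t * s))"
    using sum_matchings_subsets[OF M assms(2,3)] by (simp flip: of_nat_sum of_nat_mult)
  also have "\<dots> \<le> c ^ t * real (block_seqs s t (card S)) * real ((card S - t * s) choose (k - t * s))"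
    using up by (intro mult_right_mono) auto
  also have "\<dots> = c ^ t * real (block_seqs s t k * (card S choose k))"
    using block_seqs_choose[OF assms(3,4)] by simp
  finally have "real (card A) * c' ^ t * ?P \<le> (c ^ t * real (card S choose k)) * ?P"
    by (simp add: algebra_simps)
  then have "real (card A) * c' ^ t \<le> c ^ t * real (card S choose k)" using P by simp
  then show ?thesis using assms(5) by (simp add: field_simps)
qed

lemma power_le_fact_mult_choose:
  fixes \<theta> :: real
  assumes "0 < \<theta>" "\<theta> \<le> 1" "K' \<le> K" "0 < K"
    and "real s * (real K - real K' + real s) \<le> \<theta> / 2 * real K"
  shows "real K ^ s \<le> (1 + \<theta>) * fact s * real (K' choose s)"
proof (cases "s = 0")
  case False
  define \<gamma> where "\<gamma> = (real K - real K' + real s) / real K"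
  have g0: "\<gamma> \<ge> 0" using assms by (simp add: \<gamma>_def)
  have gs: "real s * \<gamma> \<le> \<theta> / 2" using assms by (simp add: \<gamma>_def divide_simps mult.commute)
  have "\<gamma> \<le> real s * \<gamma>" using False g0 by (simp add: mult_le_cancel_right1)
  then have g1: "\<gamma> \<le> 1" using gs assms by linarith
  have eq: "real K * (1 - \<gamma>) = real K' - real s" using assms by (simp add: \<gamma>_def field_simps)
  have "0 \<le> real K * (1 - \<gamma>)" using g1 by simp
  then have sK: "s \<le> K'" using eq by linarith
  have "1 - \<theta> / 2 \<le> 1 + real s * (- \<gamma>)" using gs by simp
  also have "\<dots> \<le> (1 - \<gamma>) ^ s" using Bernoulli_inequality[of "- \<gamma>" s] g1 by simp
  finally have ber: "1 - \<theta> / 2 \<le> (1 - \<gamma>) ^ s" .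
  have "1 \<le> (1 + \<theta>) * (1 - \<theta> / 2)" using mult_left_le[of \<theta> \<theta>] assms by (simp add: algebra_simps)
  also have "\<dots> \<le> (1 + \<theta>) * (1 - \<gamma>) ^ s" using ber assms by (intro mult_left_mono) auto
  finally have "real K ^ s * 1 \<le> real K ^ s * ((1 + \<theta>) * (1 - \<gamma>) ^ s)"
    by (intro mult_left_mono) auto
  also have "\<dots> = (1 + \<theta>) * (real K' - real s) ^ s"
    unfolding eq[symmetric] by (simp add: power_mult_distrib)
  also have "(real K' - real s) ^ s = (\<Prod>i<s. real K' - real s)" by simp
  also have "\<dots> \<le> (\<Prod>i<s. real K' - real i)" using sK by (intro prod_mono) auto
  also have "\<dots> = fact s * real (K' choose s)"
    by (simp add: binomial_gbinomial gbinomial_prod_rev atLeast0LessThan)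
  finally show ?thesis using assms by (simp add: mult.assoc mult_left_mono)
qed (use assms in auto)

lemma fact_mult_choose_le_power: "fact s * real (n choose s) \<le> real n ^ s"
  using binomial_fact_pow[of n s] by (metis mult.commute of_nat_fact of_nat_le_iff of_nat_mult of_nat_power)

lemma card_sparse_subsets_le:
  fixes d \<theta> :: real
  assumes L: "\<And>B. B \<in> L \<Longrightarrow> B \<subseteq> S \<and> card B = s" and "finite S" and "k \<le> card S" "0 < k" "t * s \<le> k"
    and th: "0 < \<theta>" "\<theta> \<le> 1" and d: "4 * \<theta> \<le> d" "d \<le> 1"
    and dens: "real (card L) \<ge> d * real (card S choose s)"
    and t: "real s * (real t * real s + real s) \<le> \<theta> / 2 * real k"
    and A: "\<And>U. U \<in> A \<Longrightarrow> U \<subseteq> S \<and> card U = k \<and>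
        real (card {B \<in> L. B \<subseteq> U}) \<le> (d - 4 * \<theta>) * real (k choose s)"
  shows "real (card A) \<le> ((1 + \<theta>) / (1 + 3 * \<theta>)) ^ t * real (card S choose k)"
proof -
  define M where "M = {B. B \<subseteq> S \<and> card B = s \<and> B \<notin> L}"
  have M: "card B = s" if "B \<in> M" for B using that by (simp add: M_def)
  have split: "card {B. B \<in> M \<and> B \<subseteq> T} + card {B \<in> L. B \<subseteq> T} = (card T choose s)" if "T \<subseteq> S" for T
  proof -
    have fT: "finite T" using that assms(2) finite_subset by blast
    have "{B. B \<subseteq> T \<and> card B = s} = {B. B \<in> M \<and> B \<subseteq> T} \<union> {B \<in> L. B \<subseteq> T}"
      using that L by (auto simp: M_def)
    moreover have "card ({B. B \<in> M \<and> B \<subseteq> T} \<union> {B \<in> L. B \<subseteq> T}) = card {B. B \<in> M \<and> B \<subseteq> T} + card {B \<in> L. B \<subseteq> T}"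
      using fT by (intro card_Un_disjoint) (auto simp: M_def intro: finite_subset[of _ "Pow T"])
    ultimately show ?thesis using n_subsets[OF fT, of s] by simp
  qed
  have ratio: "real (card T choose s) \<le> (1 + \<theta>) * real (card T' choose s)"
    if "T' \<subseteq> T" "T \<subseteq> S" "k \<le> card T" "card T \<le> card T' + t * s" for T T'
  proof -
    have fT: "finite T" using that assms(2) finite_subset by blast
    have T'T: "card T' \<le> card T" using fT that card_mono by blast
    have "real (card T) \<le> real (card T') + real t * real s"
      using that(4) by (metis of_nat_add of_nat_le_iff of_nat_mult)
    then have "real s * (real (card T) - real (card T') + real s) \<le> real s * (real t * real s + real s)"
      by (intro mult_left_mono) auto
    with t have "real s * (real (card T) - real (card T') + real s) \<le> \<theta> / 2 * real k" by linarith
    also have "\<dots> \<le> \<theta> / 2 * real (card T)" using that th by (intro mult_left_mono) auto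
    finally have "real s * (real (card T) - real (card T') + real s) \<le> \<theta> / 2 * real (card T)" .
    with T'T have "real (card T) ^ s \<le> (1 + \<theta>) * fact s * real (card T' choose s)"
      using power_le_fact_mult_choose th that assms(4) by auto
    then have "fact s * real (card T choose s) \<le> fact s * ((1 + \<theta>) * real (card T' choose s))"
      using fact_mult_choose_le_power[of s "card T"] by (simp add: algebra_simps)
    then show ?thesis by (simp add: mult_le_cancel_left_pos)
  qed
  define c c' where "c = 1 - d + \<theta>" and "c' = 1 - d + 3 * \<theta>"
  have up: "real (ordered_matchings M t S) \<le> c ^ t * real (block_seqs s t (card S))"
  proof (rule matchings_le[OF M _ assms(2)])
    fix S' assume S': "S' \<subseteq> S" "card S \<le> card S' + t * s"
    have LS: "{B \<in> L. B \<subseteq> S} = L" using L by auto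
    have "card {B. B \<in> M \<and> B \<subseteq> S'} \<le> card {B. B \<in> M \<and> B \<subseteq> S}"
      using S' assms(2) by (intro card_mono) (auto intro: finite_subset[of _ "Pow S"])
    then have "real (card {B. B \<in> M \<and> B \<subseteq> S'}) \<le> (1 - d) * real (card S choose s)"
      using split[of S] LS dens by (simp add: algebra_simps)
    also have "\<dots> \<le> (1 - d) * ((1 + \<theta>) * real (card S' choose s))"
      using ratio[OF S'(1) _ _ S'(2)] assms(3) d by (intro mult_left_mono) auto
    also have "\<dots> = ((1 - d) * (1 + \<theta>)) * real (card S' choose s)" by simp
    also have "\<dots> \<le> c * real (card S' choose s)"
      using th d by (intro mult_right_mono) (auto simp: c_def algebra_simps)
    finally show "real (card {B. B \<in> M \<and> B \<subseteq> S'}) \<le> c * real (card S' choose s)" .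
  qed (use th d in \<open>auto simp: c_def\<close>)
  have low: "real (ordered_matchings M t U) \<ge> c' ^ t * real (block_seqs s t k)" if "U \<in> A" for U
  proof -
    have U: "U \<subseteq> S" "card U = k" and few: "real (card {B \<in> L. B \<subseteq> U}) \<le> (d - 4 * \<theta>) * real (k choose s)"
      using A that by auto
    have fU: "finite U" using U assms(2) finite_subset by blast
    have "c' ^ t * real (block_seqs s t (card U)) \<le> real (ordered_matchings M t U)"
    proof (rule matchings_ge[OF M _ fU])
      fix S' assume S': "S' \<subseteq> U" "card U \<le> card S' + t * s"
      have "card {B \<in> L. B \<subseteq> S'} \<le> card {B \<in> L. B \<subseteq> U}"
        using S' fU by (intro card_mono) (auto intro: finite_subset[of _ "Pow U"])
      then have "real (card {B \<in> L. B \<subseteq> S'}) \<le> (d - 4 * \<theta>) * real (k choose s)"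
        using few by linarith
      also have "\<dots> \<le> (d - 4 * \<theta>) * ((1 + \<theta>) * real (card S' choose s))"
        using ratio[OF S'(1) U(1) _ S'(2)] U d by (intro mult_left_mono) auto
      also have "\<dots> = ((d - 4 * \<theta>) * (1 + \<theta>)) * real (card S' choose s)" by simp
      also have "\<dots> \<le> (1 - c') * real (card S' choose s)"
      proof (intro mult_right_mono)
        have "(d - 4 * \<theta>) * \<theta> \<le> 1 * \<theta>" using th d by (intro mult_right_mono) auto
        then show "(d - 4 * \<theta>) * (1 + \<theta>) \<le> 1 - c'" by (simp add: c'_def algebra_simps)
      qed auto
      finally have "real (card {B \<in> L. B \<subseteq> S'}) \<le> (1 - c') * real (card S' choose s)" .
      moreover have "real (card {B. B \<in> M \<and> B \<subseteq> S'}) + real (card {B \<in> L. B \<subseteq> S'}) = real (card S' choose s)"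
        using split[of S'] S' U by (metis dual_order.trans of_nat_add)
      ultimately show "c' * real (card S' choose s) \<le> real (card {B. B \<in> M \<and> B \<subseteq> S'})"
        by (simp add: algebra_simps)
    qed (use th d in \<open>auto simp: c'_def\<close>)
    then show ?thesis using U by simp
  qed
  have c'pos: "c' > 0" using th d by (simp add: c'_def)
  have "real (card A) \<le> (c / c') ^ t * real (card S choose k)"
  proof (rule card_matching_rich_subsets_le[OF M assms(2,5,3) c'pos up])
    show "U \<subseteq> S \<and> card U = k \<and> c' ^ t * real (block_seqs s t k) \<le> real (ordered_matchings M t U)"
      if "U \<in> A" for U using A[OF that] low[OF that] by simp
  qed
  also have "\<dots> \<le> ((1 + \<theta>) / (1 + 3 * \<theta>)) ^ t * real (card S choose k)"
  proof (intro mult_right_mono power_mono)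
    have "\<theta> * d \<ge> 0" using th d by simp
    then have "c * (1 + 3 * \<theta>) \<le> (1 + \<theta>) * c'"
      by (simp add: c_def c'_def algebra_simps)
    then show "c / c' \<le> (1 + \<theta>) / (1 + 3 * \<theta>)" using c'pos th by (simp add: divide_simps)
    show "0 \<le> c / c'" using c'pos th d by (simp add: c_def)
  qed auto
  finally show ?thesis .
qed

lemma summable_mult_power_div:
  fixes \<beta> :: real
  assumes "0 < \<beta>" "\<beta> < 1" "q > 0"
  shows "summable (\<lambda>k. real k * \<beta> ^ (k div q))"
proof -
  define \<rho> where "\<rho> = \<beta> powr (1 / real q)"
  have rho: "0 < \<rho>" "\<rho> < 1" using assms powr_less_mono2[of "1 / real q" \<beta> 1] by (auto simp: \<rho>_def)
  have "summable (\<lambda>k. real (Suc k) * \<rho> ^ k)"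
    using geometric_deriv_sums[of \<rho>] rho by (simp add: sums_iff)
  then have "summable (\<lambda>k. (1 / \<beta>) * (real (Suc k) * \<rho> ^ k))" by (rule summable_mult)
  then show ?thesis
  proof (rule summable_comparison_test'[where N = 0])
    fix k
    have "k < q * Suc (k div q)" using assms(3) dividend_less_times_div[of q k] by simp
    then have "real k \<le> real q * (real (k div q) + 1)"
      by (metis less_imp_le of_nat_Suc of_nat_le_iff of_nat_mult add.commute)
    then have le: "real k / real q - 1 \<le> real (k div q)" using assms(3) by (simp add: field_simps)
    have "\<beta> ^ (k div q) = \<beta> powr real (k div q)" using assms by (simp add: powr_realpow)
    also have "\<dots> \<le> \<beta> powr (real k / real q - 1)" using le assms by (intro powr_mono') auto
    also have "\<dots> = \<rho> ^ k / \<beta>"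
      using assms rho by (simp add: \<rho>_def powr_diff powr_powr flip: powr_realpow)
    finally have "real k * \<beta> ^ (k div q) \<le> real (Suc k) * (\<rho> ^ k / \<beta>)"
      using assms rho by (intro mult_mono) auto
    then show "norm (real k * \<beta> ^ (k div q)) \<le> (1 / \<beta>) * (real (Suc k) * \<rho> ^ k)"
      using assms by (simp add: algebra_simps add_divide_distrib)
  qed
qed

lemma choose_mult_power_le:
  assumes "m \<le> n"
  shows "(m choose r) * n ^ r \<le> (n choose r) * m ^ r"
proof (induction r)
  case (Suc r)
  have step: "(k - r) * (k choose r) = Suc r * (k choose Suc r)" for k
    using binomial_absorb_comp[of k r] binomial_absorption[of r k] by (cases k) (auto simp: algebra_simps)
  have "(m - r) * n \<le> (n - r) * m"
    unfolding diff_mult_distrib using assms by (simp only: mult.commute[of m n]) (intro diff_le_mono2 mult_le_mono2)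
  then have "((m - r) * n) * ((m choose r) * n ^ r) \<le> ((n - r) * m) * ((n choose r) * m ^ r)"
    using Suc by (rule mult_mono) auto
  then have "((m - r) * (m choose r)) * n ^ Suc r \<le> ((n - r) * (n choose r)) * m ^ Suc r"
    by (simp add: algebra_simps)
  then have "Suc r * ((m choose Suc r) * n ^ Suc r) \<le> Suc r * ((n choose Suc r) * m ^ Suc r)"
    unfolding step by (simp add: algebra_simps)
  then show ?case by (simp only: mult_le_cancel1)
qed auto

lemma card_subsets_containing_member_le:
  assumes "finite V" "finite D" "\<And>e. e \<in> D \<Longrightarrow> e \<subseteq> V \<and> card e = r" "r \<le> m" "m \<le> card V"
  shows "card {U. U \<subseteq> V \<and> card U = m \<and> (\<exists>e\<in>D. e \<subseteq> U)} * card V ^ r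
       \<le> card D * ((card V choose m) * m ^ r)"
proof -
  let ?n = "card V"
  have "{U. U \<subseteq> V \<and> card U = m \<and> (\<exists>e\<in>D. e \<subseteq> U)} = (\<Union>e\<in>D. {U. U \<subseteq> V \<and> card U = m \<and> e \<subseteq> U})" by auto
  then have "card {U. U \<subseteq> V \<and> card U = m \<and> (\<exists>e\<in>D. e \<subseteq> U)}
      \<le> (\<Sum>e\<in>D. card {U. U \<subseteq> V \<and> card U = m \<and> e \<subseteq> U})"
    using card_UN_le[OF assms(2)] by simp
  also have "\<dots> = (\<Sum>e\<in>D. (?n - r) choose (m - r))"
    using assms card_supersets[OF assms(1)] by (intro sum.cong) auto
  finally have le: "card {U. U \<subseteq> V \<and> card U = m \<and> (\<exists>e\<in>D. e \<subseteq> U)} \<le> card D * ((?n - r) choose (m - r))"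
    by simp
  have "(?n choose r) * (((?n - r) choose (m - r)) * ?n ^ r) = (?n choose m) * ((m choose r) * ?n ^ r)"
    using choose_mult[OF assms(4,5)] by (simp add: algebra_simps)
  also have "\<dots> \<le> (?n choose m) * ((?n choose r) * m ^ r)"
    using choose_mult_power_le[OF assms(5)] by (intro mult_left_mono) auto
  finally have "(?n choose r) * (((?n - r) choose (m - r)) * ?n ^ r) \<le> (?n choose r) * ((?n choose m) * m ^ r)"
    by (simp add: algebra_simps)
  moreover have "(?n choose r) > 0" using assms by simp
  ultimately have "((?n - r) choose (m - r)) * ?n ^ r \<le> (?n choose m) * m ^ r" by simp
  then have "card D * (((?n - r) choose (m - r)) * ?n ^ r) \<le> card D * ((?n choose m) * m ^ r)"
    by (intro mult_left_mono) auto
  moreover have "card {U. U \<subseteq> V \<and> card U = m \<and> (\<exists>e\<in>D. e \<subseteq> U)} * ?n ^ r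
     \<le> card D * ((?n - r) choose (m - r)) * ?n ^ r"
    using le by (rule mult_right_mono) auto
  ultimately show ?thesis unfolding mult.assoc by (rule order_trans[rotated])
qed

definition induced :: "'a hypergraph \<Rightarrow> 'a set \<Rightarrow> 'a hypergraph" where
  "induced H U = Hypergraph U {e \<in> edges H. e \<subseteq> U}"

lemma verts_induced [simp]: "verts (induced H U) = U"
  and edges_induced [simp]: "edges (induced H U) = {e \<in> edges H. e \<subseteq> U}"
  by (auto simp: induced_def)

lemma rgraph_induced: "rgraph r H \<Longrightarrow> U \<subseteq> verts H \<Longrightarrow> rgraph r (induced H U)"
  by (auto simp: rgraph_def intro: finite_subset)

lemma family_free_induced:
  assumes "family_free \<F> H" "U \<subseteq> verts H"
  shows "family_free \<F> (induced H U)"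
proof -
  have "subgraph G H" if "subgraph G (induced H U)" for G
    using that assms(2) by (auto simp: subgraph_def)
  then show ?thesis using assms(1) by (auto simp: family_free_def)
qed

lemma induced_verts: "rgraph r H \<Longrightarrow> induced H (verts H) = H"
  by (cases H) (auto simp: induced_def rgraph_def)

lemma delete_vertex_induced: "delete_vertex (induced H U) v = induced H (U - {v})"
  by (auto simp: delete_vertex_def induced_def)

lemma finite_edges: "rgraph r H \<Longrightarrow> finite (edges H)"
  by (auto simp: rgraph_def intro: finite_subset[of _ "Pow (verts H)"])

lemma sum_vertex_degree:
  assumes "rgraph r H"
  shows "(\<Sum>v\<in>verts H. vertex_degree H v) = r * card (edges H)"
  unfolding vertex_degree_def
proof (rule sum_multicount)
  show "\<forall>e\<in>edges H. card {v \<in> verts H. v \<in> e} = r"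
  proof
    fix e assume "e \<in> edges H"
    then have "{v \<in> verts H. v \<in> e} = e" "card e = r" using assms by (auto simp: rgraph_def)
    then show "card {v \<in> verts H. v \<in> e} = r" by simp
  qed
qed (use assms finite_edges in \<open>auto simp: rgraph_def\<close>)

definition link :: "'a hypergraph \<Rightarrow> 'a \<Rightarrow> 'a set set" where
  "link H v = (\<lambda>e. e - {v}) ` {e \<in> edges H. v \<in> e}"

lemma vertex_degree_induced_eq:
  assumes "v \<in> U"
  shows "vertex_degree (induced H U) v = card {B \<in> link H v. B \<subseteq> U - {v}}"
proof -
  have "{B \<in> link H v. B \<subseteq> U - {v}} = (\<lambda>e. e - {v}) ` {e \<in> {e \<in> edges H. e \<subseteq> U}. v \<in> e}"
    using assms by (auto simp: link_def)
  moreover have "inj_on (\<lambda>e. e - {v}) {e \<in> {e \<in> edges H. e \<subseteq> U}. v \<in> e}"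
    by (auto simp: inj_on_def)
  ultimately show ?thesis by (simp add: vertex_degree_def card_image)
qed

lemma large_min_degree_iff:
  assumes "finite (verts H)" "verts H \<noteq> {}"
  shows "large_min_degree r \<F> \<epsilon> H \<longleftrightarrow> (\<forall>v\<in>verts H. real (vertex_degree H v)
       \<ge> (turan_density r \<F> / fact (r - 1) - \<epsilon>) * real (card (verts H)) ^ (r - 1))"
proof -
  have "x \<le> real (min_degree H) \<longleftrightarrow> (\<forall>v\<in>verts H. x \<le> real (vertex_degree H v))" for x
  proof
    assume "x \<le> real (min_degree H)"
    moreover have "min_degree H \<le> vertex_degree H v" if "v \<in> verts H" for v
      using that assms by (simp add: min_degree_def)
    ultimately show "\<forall>v\<in>verts H. x \<le> real (vertex_degree H v)" by (meson of_nat_le_iff order_trans)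
  next
    assume *: "\<forall>v\<in>verts H. x \<le> real (vertex_degree H v)"
    have "min_degree H \<in> vertex_degree H ` verts H"
      unfolding min_degree_def using assms by (intro Min_in) auto
    then show "x \<le> real (min_degree H)" using * by auto
  qed
  then show ?thesis by (simp add: large_min_degree_def)
qed


lemma card_low_degree_subsets_le:
  fixes \<pi> \<theta> \<epsilon> :: real
  assumes H: "rgraph (Suc s) H" and th: "0 < \<theta>" "\<theta> \<le> 1" "5 * \<theta> \<le> \<pi>" "6 * \<theta> \<le> \<epsilon>"
    and s: "s \<ge> 1" and q: "8 * real s ^ 2 / \<theta> \<le> real q" and k: "q \<le> k" "k \<le> card (verts H)"
    and deg: "\<And>v. v \<in> verts H \<Longrightarrow>
        real (vertex_degree H v) \<ge> (\<pi> - \<theta>) / fact s * real (card (verts H)) ^ s"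
  shows "real (card {U. U \<subseteq> verts H \<and> card U = k \<and> (\<exists>v\<in>U.
           real (vertex_degree (induced H U) v) < (\<pi> / fact s - \<epsilon>) * real k ^ s)})
       \<le> real k * ((1 + \<theta>) / (1 + 3 * \<theta>)) ^ (k div q) * real (card (verts H) choose k)"
proof -
  let ?V = "verts H" and ?n = "card (verts H)" and ?\<beta> = "(1 + \<theta>) / (1 + 3 * \<theta>)"
  define t where "t = k div q"
  define bad where "bad U v \<longleftrightarrow> real (vertex_degree (induced H U) v) < (\<pi> / fact s - \<epsilon>) * real k ^ s" for U v
  have fV: "finite ?V" using H by (simp add: rgraph_def)
  have s2: "real s \<le> real s ^ 2" "1 \<le> real s ^ 2" using s by (auto simp: self_le_power)
  have ths: "8 * real s ^ 2 \<le> \<theta> * real q" using q th by (simp add: field_simps)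
  also have "\<dots> \<le> 1 * real q" using th by (intro mult_right_mono) auto
  finally have q8: "8 \<le> real q" using s2 by linarith
  then have q0: "q > 0" and k8: "k \<ge> 8" using k by linarith+
  have "t * q \<le> k" by (simp add: t_def)
  then have "real t * real q \<le> real k" by (metis of_nat_le_iff of_nat_mult)
  then have "\<theta> * (real t * real q) \<le> \<theta> * real k" using th by (intro mult_left_mono) auto
  moreover have "real t * (8 * real s ^ 2) \<le> real t * (\<theta> * real q)" using ths by (intro mult_left_mono) auto
  ultimately have t1: "8 * (real s ^ 2 * real t) \<le> \<theta> * real k" by (simp add: mult_ac)
  have "\<theta> * real q \<le> \<theta> * real k" using k th by (intro mult_left_mono) auto
  then have t2: "8 * real s ^ 2 \<le> \<theta> * real k" using ths by linarith
  have "\<theta> * 2 \<le> \<theta> * real k" using k8 th by (intro mult_left_mono) auto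
  then have "\<theta> * real k / 4 \<le> \<theta> / 2 * real (k - 1)" using k8 by (simp add: of_nat_diff algebra_simps)
  then have t3: "real s * (real t * real s + real s) \<le> \<theta> / 2 * real (k - 1)"
    using t1 t2 by (simp add: algebra_simps power2_eq_square)
  have st: "real s * real t \<le> real s ^ 2 * real t" using s2 by (intro mult_right_mono) auto
  have thk: "\<theta> * real k \<le> 1 * real k" using th by (intro mult_right_mono) auto
  have "real (t * s) \<le> real k / 8" using t1 st thk by (simp add: mult.commute)
  then have ts: "t * s \<le> k - 1" using k8 by linarith
  have per_vertex: "real (card {U. U \<subseteq> ?V \<and> card U = k \<and> v \<in> U \<and> bad U v})
      \<le> ?\<beta> ^ t * real ((?n - 1) choose (k - 1))" if v: "v \<in> ?V" for v
  proof -
    let ?X = "{U. U \<subseteq> ?V \<and> card U = k \<and> v \<in> U \<and> bad U v}"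
    let ?L = "link H v" and ?S = "?V - {v}"
    have L: "B \<subseteq> ?S \<and> card B = s" if "B \<in> ?L" for B
    proof -
      obtain e where e: "e \<in> edges H" "v \<in> e" "B = e - {v}" using \<open>B \<in> ?L\<close> by (auto simp: link_def)
      then have "e \<subseteq> ?V" "card e = Suc s" using H by (auto simp: rgraph_def)
      then show ?thesis using e by (auto simp: card_Diff_singleton)
    qed
    have cS: "card ?S = ?n - 1" using v by simp
    have "{B \<in> ?L. B \<subseteq> ?S} = ?L" using L by auto
    then have cL: "vertex_degree H v = card ?L"
      using vertex_degree_induced_eq[OF v, of H] induced_verts[OF H] by simp
    define d where "d = \<pi> - \<theta>"
    have "d * real ((?n - 1) choose s) \<le> d * (real ?n ^ s / fact s)"
    proof (rule mult_left_mono)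
      have "fact s * real ((?n - 1) choose s) \<le> real (?n - 1) ^ s" by (rule fact_mult_choose_le_power)
      also have "\<dots> \<le> real ?n ^ s" by (intro power_mono) auto
      finally show "real ((?n - 1) choose s) \<le> real ?n ^ s / fact s" by (simp add: field_simps)
    qed (use th in \<open>auto simp: d_def\<close>)
    also have "\<dots> \<le> real (card ?L)" using deg[OF v] cL by (simp add: d_def)
    finally have dens: "d * real (card ?S choose s) \<le> real (card ?L)" using cS by simp
    have "card ?L \<le> card {B. B \<subseteq> ?S \<and> card B = s}"
      using L fV by (intro card_mono) (auto intro: finite_subset[of _ "Pow ?S"])
    then have "real (card ?L) \<le> 1 * real (card ?S choose s)" using n_subsets[of ?S s] fV by simp
    then have "d * real (card ?S choose s) \<le> 1 * real (card ?S choose s)" using dens by linarith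
    moreover have "real s \<le> real k / 8" using s2(1) t2 thk by linarith
    then have "s \<le> card ?S" using cS k k8 by linarith
    then have "real (card ?S choose s) > 0" by simp
    ultimately have d1: "d \<le> 1" by (simp only: mult_le_cancel_right_pos)
    have "real (card ((\<lambda>U. U - {v}) ` ?X)) \<le> ?\<beta> ^ t * real (card ?S choose (k - 1))"
    proof (rule card_sparse_subsets_le[where L = ?L and d = d and s = s])
      fix W assume "W \<in> (\<lambda>U. U - {v}) ` ?X"
      then obtain U where U: "U \<subseteq> ?V" "card U = k" "v \<in> U" "bad U v" and W: "W = U - {v}" by auto
      have "real (card {B \<in> ?L. B \<subseteq> W}) \<le> (d - 4 * \<theta>) * real ((k - 1) choose s)"
      proof (rule ccontr)
        assume "\<not> ?thesis"
        then have more: "(d - 4 * \<theta>) * real ((k - 1) choose s) < real (vertex_degree (induced H U) v)"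
          using vertex_degree_induced_eq[OF U(3), of H] W by simp
        have "real k ^ s \<le> (1 + \<theta>) * fact s * real ((k - 1) choose s)"
        proof (rule power_le_fact_mult_choose)
          show "real s * (real k - real (k - 1) + real s) \<le> \<theta> / 2 * real k"
            using k8 s2 t2 by (simp add: of_nat_diff algebra_simps power2_eq_square)
        qed (use th k8 in auto)
        then have "(1 - \<theta>) * real k ^ s \<le> (1 - \<theta>) * ((1 + \<theta>) * (fact s * real ((k - 1) choose s)))"
          using th by (intro mult_left_mono) (auto simp: mult.assoc)
        also have "\<dots> = (1 - \<theta> * \<theta>) * (fact s * real ((k - 1) choose s))"
          by (simp add: algebra_simps)
        also have "\<dots> \<le> 1 * (fact s * real ((k - 1) choose s))" by (intro mult_right_mono) auto
        finally have A: "(1 - \<theta>) * real k ^ s \<le> fact s * real ((k - 1) choose s)" by simp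
        have "\<theta> * (d - 4 * \<theta>) \<le> \<theta> * 1" using d1 th by (intro mult_left_mono) auto
        then have "\<pi> - \<epsilon> \<le> (d - 4 * \<theta>) * (1 - \<theta>)" using th by (simp add: d_def algebra_simps)
        moreover have "\<epsilon> * 1 \<le> \<epsilon> * fact s" using th by (intro mult_left_mono) (auto simp: fact_ge_1)
        ultimately have "(\<pi> - \<epsilon> * fact s) * real k ^ s \<le> ((d - 4 * \<theta>) * (1 - \<theta>)) * real k ^ s"
          by (intro mult_right_mono) auto
        also have "\<dots> \<le> (d - 4 * \<theta>) * (fact s * real ((k - 1) choose s))"
          using A th unfolding mult.assoc by (intro mult_left_mono) (auto simp: d_def)
        also have "\<dots> < fact s * real (vertex_degree (induced H U) v)"
          using more by (simp add: mult.left_commute)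
        also have "(\<pi> - \<epsilon> * fact s) * real k ^ s = fact s * ((\<pi> / fact s - \<epsilon>) * real k ^ s)"
          by (simp add: field_simps)
        finally have "fact s * ((\<pi> / fact s - \<epsilon>) * real k ^ s) < fact s * real (vertex_degree (induced H U) v)" .
        then have "(\<pi> / fact s - \<epsilon>) * real k ^ s < real (vertex_degree (induced H U) v)"
          by (simp add: mult_less_cancel_left_pos)
        then show False using U(4) by (simp add: bad_def)
      qed
      then show "W \<subseteq> ?S \<and> card W = k - 1 \<and>
          real (card {B \<in> ?L. B \<subseteq> W}) \<le> (d - 4 * \<theta>) * real ((k - 1) choose s)"
        using U W by auto
    qed (use L fV cS k k8 ts t3 th d1 dens in \<open>auto simp: d_def\<close>)
    moreover have "inj_on (\<lambda>U. U - {v}) ?X" by (auto simp: inj_on_def)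
    ultimately show ?thesis using cS by (simp add: card_image)
  qed
  have "card {U. U \<subseteq> ?V \<and> card U = k \<and> (\<exists>v\<in>U. bad U v)}
      \<le> card (\<Union>v\<in>?V. {U. U \<subseteq> ?V \<and> card U = k \<and> v \<in> U \<and> bad U v})"
    using fV by (intro card_mono) (auto intro: finite_subset[of _ "Pow ?V"])
  also have "\<dots> \<le> (\<Sum>v\<in>?V. card {U. U \<subseteq> ?V \<and> card U = k \<and> v \<in> U \<and> bad U v})"
    by (rule card_UN_le[OF fV])
  finally have "real (card {U. U \<subseteq> ?V \<and> card U = k \<and> (\<exists>v\<in>U. bad U v)})
      \<le> (\<Sum>v\<in>?V. real (card {U. U \<subseteq> ?V \<and> card U = k \<and> v \<in> U \<and> bad U v}))"
    by (metis (no_types, lifting) of_nat_le_iff of_nat_sum sum.cong)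
  also have "\<dots> \<le> (\<Sum>v\<in>?V. ?\<beta> ^ t * real ((?n - 1) choose (k - 1)))"
    by (rule sum_mono[OF per_vertex])
  also have "\<dots> = ?\<beta> ^ t * real (?n * ((?n - 1) choose (k - 1)))" by simp
  also have "?n * ((?n - 1) choose (k - 1)) = k * (?n choose k)"
    using times_binomial_minus1_eq[of k ?n] k8 by simp
  finally show ?thesis by (simp add: bad_def t_def mult_ac)
qed

theorem theorem1p1:
  fixes r :: nat and \<F> \<HH> :: "'a::infinite hypergraph set"
  assumes "r \<ge> 2"
    and "\<forall>F\<in>\<F>. rgraph r F"
    and "nondegenerate r \<F>"
    and "\<forall>H\<in>\<HH>. rgraph r H \<and> family_free \<F> H"
    and "hereditary \<HH>"
    and "edge_stable r \<F> \<HH>"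
    and "vertex_extendable r \<F> \<HH>"
  shows "degree_stable r \<F> \<HH>"
proof -
  define s where "s = r - 1"
  have r: "r = Suc s" and s: "s \<ge> 1" using assms(1) by (auto simp: s_def)
  define \<pi> where "\<pi> = turan_density r \<F>"
  have pi: "\<pi> > 0" using assms(3) by (simp add: nondegenerate_def \<pi>_def)
  obtain \<epsilon>2 n2 where e2: "\<epsilon>2 > 0" and ext: "\<And>H v. rgraph r H \<Longrightarrow> family_free \<F> H \<Longrightarrow>
      card (verts H) \<ge> n2 \<Longrightarrow> large_min_degree r \<F> \<epsilon>2 H \<Longrightarrow> v \<in> verts H \<Longrightarrow>
      delete_vertex H v \<in> \<HH> \<Longrightarrow> H \<in> \<HH>"
    using assms(7) unfolding vertex_extendable_def by blast
  define \<theta> where "\<theta> = min 1 (min (\<pi> / 5) (\<epsilon>2 / 6))"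
  have th: "0 < \<theta>" "\<theta> \<le> 1" "5 * \<theta> \<le> \<pi>" "6 * \<theta> \<le> \<epsilon>2" using pi e2 by (auto simp: \<theta>_def)
  define \<beta> where "\<beta> = (1 + \<theta>) / (1 + 3 * \<theta>)"
  have be: "0 < \<beta>" "\<beta> < 1" using th by (auto simp: \<beta>_def)
  obtain q :: nat where q: "8 * real s ^ 2 / \<theta> \<le> real q" using real_arch_simple by blast
  have "8 * real s ^ 2 / \<theta> > 0" using s th by simp
  then have q0: "q > 0" using q by linarith
  obtain N where N: "\<And>m n. m \<ge> N \<Longrightarrow> norm (\<Sum>k=m..<n. real k * \<beta> ^ (k div q)) < 1 / 2"
    using summable_mult_power_div[OF be q0] unfolding summable_Cauchy by (metis half_gt_zero zero_less_one)
  define m where "m = Max {N, n2, q, r}"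
  have m: "m \<ge> N" "m \<ge> n2" "m \<ge> q" "m \<ge> r" by (auto simp: m_def)
  then have m0: "m > 0" using q0 by simp
  define \<delta> where "\<delta> = 1 / (2 * real m ^ r)"
  have "\<delta> > 0" using m0 by (simp add: \<delta>_def)
  then obtain \<epsilon>1 n1 where e1: "\<epsilon>1 > 0" and stab: "\<And>H. rgraph r H \<Longrightarrow> family_free \<F> H \<Longrightarrow>
      card (verts H) \<ge> n1 \<Longrightarrow> real (card (edges H)) \<ge> (\<pi> / fact r - \<epsilon>1) * real (card (verts H)) ^ r \<Longrightarrow>
      \<exists>D \<subseteq> edges H. real (card D) \<le> \<delta> * real (card (verts H)) ^ r \<and> delete_edges H D \<in> \<HH>"
    using assms(6) unfolding edge_stable_def \<pi>_def by meson
  define \<epsilon> where "\<epsilon> = min \<epsilon>1 (\<theta> / fact s)"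
  have ep: "\<epsilon> > 0" "\<epsilon> \<le> \<epsilon>1" "\<epsilon> \<le> \<theta> / fact s" using e1 th by (auto simp: \<epsilon>_def)
  have "H \<in> \<HH>" if H: "rgraph r H" "family_free \<F> H" and n: "card (verts H) \<ge> max n1 m"
    and deg: "large_min_degree r \<F> \<epsilon> H" for H
  proof (rule ccontr)
    assume notin: "H \<notin> \<HH>"
    let ?V = "verts H"
    define n where "n = card ?V"
    have fV: "finite ?V" using H by (simp add: rgraph_def)
    have nn: "n \<ge> n1" "n \<ge> m" using n by (auto simp: n_def)
    have "?V \<noteq> {}" using nn m0 by (auto simp: n_def)
    then have deg: "real (vertex_degree H v) \<ge> (\<pi> / fact s - \<epsilon>) * real n ^ s" if "v \<in> ?V" for v
      using deg that fV by (simp add: large_min_degree_iff \<pi>_def s_def n_def)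
    have deg': "real (vertex_degree H v) \<ge> (\<pi> - \<theta>) / fact s * real n ^ s" if "v \<in> ?V" for v
    proof -
      have "(\<pi> - \<theta>) / fact s * real n ^ s \<le> (\<pi> / fact s - \<epsilon>) * real n ^ s"
        using ep by (intro mult_right_mono) (auto simp: diff_divide_distrib)
      then show ?thesis using deg[OF that] by linarith
    qed
    have "real n * ((\<pi> / fact s - \<epsilon>) * real n ^ s) = (\<Sum>v\<in>?V. (\<pi> / fact s - \<epsilon>) * real n ^ s)"
      by (simp add: n_def)
    also have "\<dots> \<le> (\<Sum>v\<in>?V. real (vertex_degree H v))" using deg by (rule sum_mono)
    also have "\<dots> = real r * real (card (edges H))"
      using sum_vertex_degree[OF H(1)] by (metis of_nat_mult of_nat_sum)
    finally have "(\<pi> / fact s - \<epsilon>) * real n ^ r \<le> real r * real (card (edges H))" by (simp add: r mult_ac)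
    moreover have "real r * (\<pi> / fact r - \<epsilon>1) \<le> \<pi> / fact s - \<epsilon>"
    proof -
      have eq: "real r * (\<pi> / fact r) = \<pi> / fact s" by (simp add: r del: of_nat_Suc)
      have "1 * \<epsilon>1 \<le> real r * \<epsilon>1" using e1 r by (intro mult_right_mono) auto
      then show ?thesis using ep eq unfolding right_diff_distrib by linarith
    qed
    then have "real r * (\<pi> / fact r - \<epsilon>1) * real n ^ r \<le> (\<pi> / fact s - \<epsilon>) * real n ^ r"
      by (intro mult_right_mono) auto
    ultimately have "real r * ((\<pi> / fact r - \<epsilon>1) * real n ^ r) \<le> real r * real (card (edges H))"
      by (simp only: mult.assoc)
    then have "(\<pi> / fact r - \<epsilon>1) * real n ^ r \<le> real (card (edges H))"
      using r by (simp only: mult_le_cancel_left_pos of_nat_0_less_iff zero_less_Suc)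
    then obtain D where D: "D \<subseteq> edges H" "real (card D) \<le> \<delta> * real n ^ r" "delete_edges H D \<in> \<HH>"
      using stab[OF H] nn by (auto simp: n_def)
    define G where "G k = {U. U \<subseteq> ?V \<and> card U = k \<and> induced H U \<notin> \<HH>}" for k
    have fG: "finite (G k)" for k using fV by (auto simp: G_def intro: finite_subset[of _ "Pow ?V"])
    define p where "p k = real (card (G k)) / real (n choose k)" for k
    have pm: "p m \<le> 1 / 2"
    proof -
      have sub: "G m \<subseteq> {U. U \<subseteq> ?V \<and> card U = m \<and> (\<exists>e\<in>D. e \<subseteq> U)}"
      proof
        fix U assume U: "U \<in> G m"
        have "\<exists>e\<in>D. e \<subseteq> U"
        proof (rule ccontr)
          assume "\<not> ?thesis"
          then have "subgraph (induced H U) (delete_edges H D)"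
            using U by (auto simp: subgraph_def delete_edges_def G_def)
          then show False using U D(3) assms(5) by (auto simp: hereditary_def G_def)
        qed
        then show "U \<in> {U. U \<subseteq> ?V \<and> card U = m \<and> (\<exists>e\<in>D. e \<subseteq> U)}" using U by (simp add: G_def)
      qed
      have "card (G m) \<le> card {U. U \<subseteq> ?V \<and> card U = m \<and> (\<exists>e\<in>D. e \<subseteq> U)}"
        using sub fV by (intro card_mono) (auto intro: finite_subset[of _ "Pow ?V"])
      then have "card (G m) * n ^ r \<le> card {U. U \<subseteq> ?V \<and> card U = m \<and> (\<exists>e\<in>D. e \<subseteq> U)} * n ^ r"
        by (rule mult_right_mono) auto
      also have "\<dots> \<le> card D * ((n choose m) * m ^ r)"
        unfolding n_def using D(1) H(1) finite_edges[OF H(1)] m nn fV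
        by (intro card_subsets_containing_member_le) (auto simp: rgraph_def n_def intro: finite_subset)
      finally have "real (card (G m)) * real n ^ r \<le> real (card D) * (real (n choose m) * real m ^ r)"
        by (metis of_nat_le_iff of_nat_mult of_nat_power)
      also have "\<dots> \<le> (\<delta> * real n ^ r) * (real (n choose m) * real m ^ r)"
        using D(2) by (intro mult_right_mono) auto
      also have "\<dots> = (real (n choose m) / 2) * real n ^ r" using m0 by (simp add: \<delta>_def)
      finally have "real (card (G m)) \<le> real (n choose m) / 2"
        using nn m0 by (simp add: mult_le_cancel_right_pos)
      moreover have "real (n choose m) > 0" using nn by simp
      ultimately show ?thesis by (simp add: p_def divide_simps)
    qed
    have pstep: "p (Suc j) \<le> p j + real (Suc j) * \<beta> ^ (Suc j div q)" if j: "m \<le> j" "j < n" for j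
    proof -
      let ?k = "Suc j"
      define B where "B = {U. U \<subseteq> ?V \<and> card U = ?k \<and> (\<exists>v\<in>U.
           real (vertex_degree (induced H U) v) < (\<pi> / fact s - \<epsilon>2) * real ?k ^ s)}"
      have cB: "real (card B) \<le> real ?k * \<beta> ^ (?k div q) * real (n choose ?k)"
        unfolding B_def \<beta>_def n_def
        using H(1) th s q m j deg' by (intro card_low_degree_subsets_le) (auto simp: r n_def)
      have down: "U - {v} \<in> G j" if U: "U \<in> G ?k - B" and v: "v \<in> U" for U v
      proof -
        have UV: "U \<subseteq> ?V" "card U = ?k" "induced H U \<notin> \<HH>" using U by (auto simp: G_def)
        have fU: "finite U" using UV by (metis card.infinite nat.distinct(1))
        have "large_min_degree r \<F> \<epsilon>2 (induced H U)"
          using U UV v fU by (subst large_min_degree_iff) (auto simp: B_def not_less \<pi>_def r)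
        then have "delete_vertex (induced H U) v \<notin> \<HH>"
          using ext[of "induced H U" v] rgraph_induced[OF H(1) UV(1)] family_free_induced[OF H(2) UV(1)]
            UV v m j by auto
        then show ?thesis using UV v by (auto simp: G_def delete_vertex_induced)
      qed
      have "card (G ?k - B) * ?k = card (SIGMA U:G ?k - B. U)"
      proof -
        have "finite U" if "U \<in> G ?k" for U using that fV by (auto simp: G_def intro: finite_subset)
        then have "card (SIGMA U:G ?k - B. U) = (\<Sum>U\<in>G ?k - B. card U)"
          using fG by (intro card_SigmaI) auto
        also have "\<dots> = (\<Sum>U\<in>G ?k - B. ?k)" by (intro sum.cong) (auto simp: G_def)
        finally show ?thesis by simp
      qed
      also have "\<dots> \<le> card (SIGMA W:G j. ?V - W)"
      proof (rule card_inj_on_le)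
        show "inj_on (\<lambda>(U, v). (U - {v}, v)) (SIGMA U:G ?k - B. U)" by (auto simp: inj_on_def)
        show "(\<lambda>(U, v). (U - {v}, v)) ` (SIGMA U:G ?k - B. U) \<subseteq> (SIGMA W:G j. ?V - W)"
          using down by (auto simp: G_def)
        show "finite (SIGMA W:G j. ?V - W)" using fG fV by (intro finite_SigmaI) auto
      qed
      also have "\<dots> = card (G j) * (n - j)"
      proof -
        have "card (SIGMA W:G j. ?V - W) = (\<Sum>W\<in>G j. card (?V - W))"
          using fG fV by (intro card_SigmaI) auto
        also have "\<dots> = (\<Sum>W\<in>G j. n - j)"
          using fV by (intro sum.cong) (auto simp: G_def n_def card_Diff_subset finite_subset)
        finally show ?thesis by simp
      qed
      finally have le: "card (G ?k - B) * ?k \<le> card (G j) * (n - j)" .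
      have "(n choose j) * (n - j) = (n choose ?k) * ?k"
        using binomial_absorb_comp[of n j] binomial_absorption[of j n] j by (cases n) (auto simp: algebra_simps)
      then have "card (G j) * ((n choose ?k) * ?k) = (card (G j) * (n - j)) * (n choose j)"
        by (metis mult.assoc mult.commute)
      also have "\<dots> \<ge> (card (G ?k - B) * ?k) * (n choose j)" using le by (rule mult_right_mono) auto
      finally have "(card (G ?k - B) * (n choose j)) * ?k \<le> (card (G j) * (n choose ?k)) * ?k"
        by (simp only: mult_ac)
      then have "card (G ?k - B) * (n choose j) \<le> card (G j) * (n choose ?k)" by (simp only: mult_le_cancel2)
      then have "real (card (G ?k - B)) * real (n choose j) \<le> real (card (G j)) * real (n choose ?k)"
        by (metis of_nat_le_iff of_nat_mult)
      moreover have pos: "real (n choose j) > 0" "real (n choose ?k) > 0" using j by auto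
      ultimately have 1: "real (card (G ?k - B)) / real (n choose ?k) \<le> p j"
        by (simp add: p_def field_simps)
      have "card (G ?k) \<le> card (G ?k - B) + card B"
      proof -
        have "finite B" using fV by (auto simp: B_def intro: finite_subset[of _ "Pow ?V"])
        then have "card (G ?k) \<le> card ((G ?k - B) \<union> B)" using fG by (intro card_mono) auto
        then show ?thesis using card_Un_le order_trans by blast
      qed
      then have "p ?k \<le> real (card (G ?k - B)) / real (n choose ?k) + real (card B) / real (n choose ?k)"
        unfolding p_def add_divide_distrib[symmetric] by (intro divide_right_mono) auto
      moreover have "real (card B) / real (n choose ?k) \<le> real ?k * \<beta> ^ (?k div q)"
        using cB pos by (simp add: pos_divide_le_eq)
      ultimately show ?thesis using 1 by linarith
    qed
    have "p j \<le> p m + (\<Sum>k=Suc m..<Suc j. real k * \<beta> ^ (k div q))" if "m \<le> j" "j \<le> n" for j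
      using that
    proof (induction j rule: dec_induct)
      case (step j)
      then show ?case using pstep[of j] by simp
    qed auto
    from this[of n] have "p n \<le> p m + (\<Sum>k=Suc m..<Suc n. real k * \<beta> ^ (k div q))" using nn by simp
    moreover have "\<bar>\<Sum>k=Suc m..<Suc n. real k * \<beta> ^ (k div q)\<bar> < 1 / 2"
      using N[of "Suc m" "Suc n"] m by simp
    ultimately have "p n < 1" using pm by linarith
    moreover have "G n = {?V}"
      using card_subset_eq[OF fV] notin induced_verts[OF H(1)] by (auto simp: G_def n_def)
    then have "p n = 1" by (simp add: p_def)
    ultimately show False by simp
  qed
  then show ?thesis unfolding degree_stable_def using ep(1) by blast
qed

end
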